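(* Let $1\le r\le d$ and let $\mu_0^*\in\Sigma_r^*\subset\mathbb{C}^{2r}$. Then in a small neighborhood of $\mu_0^*$ in $\mathbb{C}^{2r}$ the Taylor mapping $\mathcal{TM}_r$ is continuously invertible: for every $\mu^*$ in a sufficiently small neighborhood of $\mu_0^*$ there is a unique rational function $R=\mathcal{TM}_r^{-1}(\mu^* )$ of the form $R=P/Q$ with $\deg P<\deg Q\le r$ whose first $2r$ Taylor coefficients at infinity are given by $\mu^*$, and $R$ depends continuously on $\mu^*$ in the topology of the space of rational functions.
   Context: For $\mu=(m_0,\dots,m_{2d-1})\in\mathbb{C}^{2d}$ let $\tilde M_d=(m_{i+j})_{0\le i\le d-1,\,0\le j\le d}$ be the $d\times(d+1)$ Hankel matrix and, for $1\le r\le d$, let $M_r=(m_{i+j})_{0\le i,j\le r-1}$. Let $\Sigma_r\subset\mathbb{C}^{2d}$ be the set of $\mu$ for which $\operatorname{rank}\tilde M_d=r$ and $\det M_r\neq 0$. Let $\pi:\mathbb{C}^{2d}\to\mathbb{C}^{2r}$ be the projection onto the first $2r$ coordinates, and $\Sigma_r^*=\pi(\Sigma_r)$. The Stieltjes space $\mathcal{S}_r$ consists of pairs $(w,\gamma)$ with $w=(x_1,\dots,x_r)\in\mathbb{C}^r$ and $\gamma=P/Q$ a rational function with $Q(z)=\prod_{i=1}^r(z-x_i)$ and $\deg P<\deg Q$. The Taylor mapping $\mathcal{TM}_r:\mathcal{S}_r\to\mathbb{C}^{2r}$ sends $(w,\gamma)$ to $(\alpha_0,\dots,\alpha_{2r-1})$,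 where $\gamma(z)=\sum_{k\ge 0}\alpha_k z^{-k-1}$ near $z=\infty$. Inversion of $\mathcal{TM}_r$ is understood as recovering the rational function $\gamma$ (the ordering of the poles in $w$ is immaterial). The space of rational functions carries its standard topology; for irreducible fractions $P/Q$ with $Q$ monic of fixed degree $r$ and $\deg P<r$, convergence is convergence of the coefficients of $P$ and $Q$. *)

theory Defs
  imports
    "HOL-Analysis.Function_Topology"
    "HOL-Computational_Algebra.Computational_Algebra"
    "HOL-Computational_Algebra.Field_as_Ring"
    "Jordan_Normal_Form.DL_Rank"
begin

(* C^n is the set of extensional functions on {..<n} (undefined outside), so the
   projection onto the first coordinates is restrict. *)
definition complex_space :: "nat \<Rightarrow> (nat \<Rightarrow> complex) topology" where
  "complex_space n = product_topology (\<lambda>_. euclidean) {..<n}"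

definition hankel_rect :: "nat \<Rightarrow> (nat \<Rightarrow> complex) \<Rightarrow> complex mat" where
  "hankel_rect d \<mu> = mat d (d + 1) (\<lambda>(i, j). \<mu> (i + j))"

definition hankel_square :: "nat \<Rightarrow> (nat \<Rightarrow> complex) \<Rightarrow> complex mat" where
  "hankel_square r \<mu> = mat r r (\<lambda>(i, j). \<mu> (i + j))"

definition Sigma_rank :: "nat \<Rightarrow> nat \<Rightarrow> (nat \<Rightarrow> complex) set" where
  "Sigma_rank d r = {\<mu> \<in> topspace (complex_space (2 * d)).
     vec_space.rank d (hankel_rect d \<mu>) = r \<and> Determinant.det (hankel_square r \<mu>) \<noteq> 0}"

definition Sigma_star :: "nat \<Rightarrow> nat \<Rightarrow> (nat \<Rightarrow> complex) set" where
  "Sigma_star d r = (\<lambda>\<mu>. restrict \<mu> {..<2 * r}) ` Sigma_rank d r"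

(* quot_of_fract R is the reduced fraction of R, with monic denominator. *)
definition ratfun_num :: "complex poly fract \<Rightarrow> complex poly" where
  "ratfun_num R = fst (quot_of_fract R)"

definition ratfun_den :: "complex poly fract \<Rightarrow> complex poly" where
  "ratfun_den R = snd (quot_of_fract R)"

definition ratfun_eval :: "complex poly fract \<Rightarrow> complex \<Rightarrow> complex" where
  "ratfun_eval R z = poly (ratfun_num R) z / poly (ratfun_den R) z"

(* The strict inequality forces Q to be nonzero.  The zero function is included for
   r > 0, as 0 / Q with Q nonconstant. *)
definition proper_ratfuns :: "nat \<Rightarrow> complex poly fract set" where
  "proper_ratfuns r = {Fract P Q | P Q. degree P < degree Q \<and> degree Q \<le> r}"

(* Used only for proper R, where the expansion at infinity has no constant term or
   polynomial part and such a sequence exists and is unique. *)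
definition taylor_at_infinity :: "complex poly fract \<Rightarrow> nat \<Rightarrow> complex" where
  "taylor_at_infinity R =
     (THE \<alpha>. \<forall>\<^sub>F z in at_infinity. (\<lambda>k. \<alpha> k * inverse z ^ (k + 1)) sums ratfun_eval R z)"

definition taylor_coeffs :: "nat \<Rightarrow> complex poly fract \<Rightarrow> nat \<Rightarrow> complex" where
  "taylor_coeffs r R = restrict (taylor_at_infinity R) {..<2 * r}"

(* P and the product need not be coprime; also, w carries the ordering of the poles. *)
definition stieltjes_space :: "nat \<Rightarrow> ((nat \<Rightarrow> complex) \<times> complex poly fract) set" where
  "stieltjes_space r = {(w, Fract P (\<Prod>i<r. [:- w i, 1:])) | w P.
     w \<in> topspace (complex_space r) \<and> degree P < degree (\<Prod>i<r. [:- w i, 1:])}"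

definition taylor_mapping ::
    "nat \<Rightarrow> (nat \<Rightarrow> complex) \<times> complex poly fract \<Rightarrow> nat \<Rightarrow> complex" where
  "taylor_mapping r = (\<lambda>(w, \<gamma>). taylor_coeffs r \<gamma>)"

(* Convergence of all coefficients of the reduced fraction with monic denominator.
   As the denominators are monic of degree at most r, their degree is locally constant:
   each set of functions with a fixed reduced degree is open and carries the topology of
   convergence of the coefficients of P and Q. *)
definition ratfun_topology :: "nat \<Rightarrow> complex poly fract topology" where
  "ratfun_topology r = pullback_topology (proper_ratfuns r)
     (\<lambda>R. (coeff (ratfun_num R), coeff (ratfun_den R))) euclidean"

end

theory Submission
  imports Defs "HOL-Analysis.FPS_Convergence"
begin

text \<open>
Take for the neighborhood all \<open>\<mu>\<close> with \<open>det M_r \<noteq> 0\<close>: this set is open because the determinant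
is a polynomial in the coordinates, and it contains \<open>\<Sigma>_r\<^sup>*\<close> because \<open>M_r\<close> involves only the
first \<open>2r - 1\<close> coordinates.

If \<open>\<alpha>\<close> is the Taylor sequence of \<open>P/Q\<close> with \<open>deg P < deg Q = r\<close>, then multiplying the expansion
at infinity by \<open>Q\<close> and comparing coefficients shows that \<open>\<alpha>\<close> starts with \<open>\<mu>\<close> precisely when the
Pade equations hold (\<open>taylor_coeffs_Fract_iff\<close>). These are \<open>r\<close> linear equations for the
coefficients of \<open>Q\<close>, of matrix \<open>M_r\<close> once \<open>Q\<close> is monic, and \<open>r\<close> formulas that express \<open>P\<close> through
\<open>Q\<close> and \<open>\<mu>\<close>. So over the neighborhood there is exactly one pair \<open>(P, Q)\<close> with \<open>Q\<close> monic of degree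
exactly \<open>r\<close> (\<open>taylor_coeffs_eq_iff_pade\<close>), and Cramer's rule makes its coefficients continuous in
\<open>\<mu>\<close> (\<open>continuous_map_coeff_pade\<close>).

It remains to pass from pairs to rational functions. Every proper rational function of degree at
most \<open>r\<close> is represented by a pair with monic denominator of degree exactly \<open>r\<close>, since
numerator and denominator can be multiplied by a power of \<open>z\<close> (\<open>proper_ratfuns_eq_monic\<close>); as \<open>\<complex>\<close> is algebraically closed, these
are also the functions occurring in the Stieltjes space. The topology, however, is defined through
the reduced fraction, so the pair must be shown to be coprime. Uniqueness of the pair gives this for
free: a common factor \<open>G\<close> of positive degree could be replaced by \<open>G + 1\<close> without changing the
rational function, which would give a second pair (\<open>coprime_pade\<close>).
\<close>

section \<open>Taylor expansion of a rational function at infinity\<close>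

lemma Fract_mult_cancel_left:
  assumes "(G :: complex poly) \<noteq> 0" "Q \<noteq> 0"
  shows "Fract (G * P) (G * Q) = Fract P Q"
  using assms by (simp add: eq_fract)

text \<open>\<open>ratfun_eval\<close> divides the values of the reduced fraction, so it can differ from \<open>P z / Q z\<close> at common
zeros of \<open>P\<close> and \<open>Q\<close>. These are finitely many, hence invisible near infinity, and the expansion can
be computed from any representation of the function.\<close>

lemma eventually_ratfun_eval_Fract:
  assumes "Q \<noteq> 0"
  shows "\<forall>\<^sub>F z in at_infinity. ratfun_eval (Fract P Q) z = poly P z / poly Q z"
proof -
  let ?N = "ratfun_num (Fract P Q)" and ?D = "ratfun_den (Fract P Q)"
  have D: "?D \<noteq> 0" by (simp add: ratfun_den_def)
  have "Fract ?N ?D = Fract P Q" by (simp add: ratfun_num_def ratfun_den_def)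
  hence cross: "?N * Q = P * ?D" using D assms by (simp add: eq_fract)
  have "bounded {z. poly (Q * ?D) z = 0}"
    using D assms by (intro finite_imp_bounded poly_roots_finite) simp
  then obtain b where b: "\<And>z. poly (Q * ?D) z = 0 \<Longrightarrow> norm z \<le> b"
    by (auto simp: bounded_iff)
  have "ratfun_eval (Fract P Q) z = poly P z / poly Q z" if "norm z \<ge> b + 1" for z
  proof -
    have "poly (Q * ?D) z \<noteq> 0" using b[of z] that by auto
    moreover have "poly ?N z * poly Q z = poly P z * poly ?D z"
      using arg_cong[OF cross, of "\<lambda>p. poly p z"] by simp
    ultimately show ?thesis by (simp add: ratfun_eval_def frac_eq_eq)
  qed
  thus ?thesis unfolding eventually_at_infinity by blast
qed

text \<open>The substitution \<open>u = 1/z\<close> turns an expansion at infinity into a power series at \<open>0\<close>. The condition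
\<open>g 0 = 0\<close> supplies the value at the center, which the punctured neighborhood does not see and where
the shifted series vanishes.\<close>

lemma eventually_at_infinity_sums_iff:
  fixes g :: "complex \<Rightarrow> complex"
  assumes "g 0 = 0"
  shows "(\<forall>\<^sub>F z in at_infinity. (\<lambda>k. \<beta> k * inverse z ^ (k + 1)) sums g (inverse z)) \<longleftrightarrow>
    g has_fps_expansion (fps_X * Abs_fps \<beta>)"
proof -
  let ?F = "fps_X * Abs_fps \<beta>"
  have shift: "(\<lambda>n. fps_nth ?F n * u ^ n) sums g u \<longleftrightarrow> (\<lambda>k. \<beta> k * u ^ (k + 1)) sums g u" for u
    using sums_Suc_iff[of "\<lambda>n. fps_nth ?F n * u ^ n" "g u"] by simp
  have at0: "(\<lambda>n. fps_nth ?F n * 0 ^ n) sums g 0"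
    using assms by simp
  have "(\<forall>\<^sub>F z in at_infinity. (\<lambda>k. \<beta> k * inverse z ^ (k + 1)) sums g (inverse z)) \<longleftrightarrow>
      (\<forall>\<^sub>F u in at 0. (\<lambda>n. fps_nth ?F n * u ^ n) sums g u)"
    by (simp only: at_to_infinity eventually_filtermap shift)
  also have "\<dots> \<longleftrightarrow> (\<forall>\<^sub>F u in nhds 0. (\<lambda>n. fps_nth ?F n * u ^ n) sums g u)"
    using at0 by (simp only: eventually_nhds_conv_at simp_thms)
  also have "\<dots> \<longleftrightarrow> g has_fps_expansion ?F"
  proof
    assume "g has_fps_expansion ?F"
    hence pos: "fps_conv_radius ?F > 0" and ev: "\<forall>\<^sub>F u in nhds 0. eval_fps ?F u = g u"
      by (auto simp: has_fps_expansion_def)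
    have "\<forall>\<^sub>F u in nhds 0. u \<in> eball 0 (fps_conv_radius ?F)"
      using pos by (intro eventually_nhds_in_open) (auto simp: zero_ereal_def)
    with ev show "\<forall>\<^sub>F u in nhds 0. (\<lambda>n. fps_nth ?F n * u ^ n) sums g u"
      by eventually_elim (metis sums_eval_fps dist_0_norm in_eball_iff)
  qed (rule has_fps_expansionI)
  finally show ?thesis .
qed

text \<open>In the variable \<open>u = 1/z\<close> the function \<open>P/Q\<close> becomes a quotient of two polynomials: with
\<open>n = deg Q\<close>, multiply numerator and denominator by \<open>u\<^sup>n\<close> to get \<open>u\<^sup>n P(1/u)\<close> and
\<open>u\<^sup>n Q(1/u)\<close>, the latter being the reflected polynomial of \<open>Q\<close>, which does not vanish at \<open>0\<close>. The
quotient therefore has a unique power series. Clearing its denominator gives an identity of formal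
power series, from which all relations between \<open>P\<close>, \<open>Q\<close> and the Taylor coefficients can be read
off.\<close>

lemma taylor_at_infinity_Fract:
  assumes "degree P < degree Q"
  shows "fps_X * Abs_fps (taylor_at_infinity (Fract P Q)) * fps_of_poly (reflect_poly Q) =
    fps_of_poly (monom 1 (degree Q - degree P) * reflect_poly P)"
proof -
  define p where "p = monom 1 (degree Q - degree P) * reflect_poly P"
  define q where "q = reflect_poly Q"
  define A where "A = fps_of_poly p / fps_of_poly q"
  define g where "g = (\<lambda>u. poly p u / poly q u)"
  have Q0: "Q \<noteq> 0" using assms by auto
  have q0: "fps_nth (fps_of_poly q) 0 \<noteq> 0" using Q0 by (simp add: q_def)
  have exp: "g has_fps_expansion A"
    unfolding g_def A_def using q0
    by (intro has_fps_expansion_divide') (auto simp: has_fps_expansion_def)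
  have g0: "g 0 = 0"
    using assms by (simp add: g_def p_def poly_monom)
  have g: "g (inverse z) = poly P z / poly Q z" if "z \<noteq> 0" for z
  proof -
    have "g (inverse z) = inverse z ^ degree Q * poly P z / (inverse z ^ degree Q * poly Q z)"
      using that assms
      by (simp add: g_def p_def q_def poly_monom poly_reflect_poly_nz mult.assoc[symmetric]
          del: power_inverse flip: power_add)
    thus ?thesis using that by simp
  qed
  have eval: "\<forall>\<^sub>F z in at_infinity. ratfun_eval (Fract P Q) z = g (inverse z)"
    using eventually_ratfun_eval_Fract[OF Q0] eventually_not_equal_at_infinity[of 0]
    by eventually_elim (simp add: g)
  have iff: "(\<forall>\<^sub>F z in at_infinity. (\<lambda>k. \<beta> k * inverse z ^ (k + 1)) sums ratfun_eval (Fract P Q) z)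
      \<longleftrightarrow> fps_X * Abs_fps \<beta> = A" for \<beta>
  proof -
    have "(\<forall>\<^sub>F z in at_infinity. (\<lambda>k. \<beta> k * inverse z ^ (k + 1)) sums ratfun_eval (Fract P Q) z) \<longleftrightarrow>
        (\<forall>\<^sub>F z in at_infinity. (\<lambda>k. \<beta> k * inverse z ^ (k + 1)) sums g (inverse z))"
      by (rule eventually_cong[OF eval]) simp
    also have "\<dots> \<longleftrightarrow> g has_fps_expansion (fps_X * Abs_fps \<beta>)"
      by (rule eventually_at_infinity_sums_iff[of g, OF g0])
    also have "\<dots> \<longleftrightarrow> fps_X * Abs_fps \<beta> = A"
    proof
      assume "g has_fps_expansion fps_X * Abs_fps \<beta>"
      thus "fps_X * Abs_fps \<beta> = A"
        using exp by (metis fps_ext fps_nth_fps_expansion)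
    qed (use exp in simp)
    finally show ?thesis .
  qed
  have "fps_nth A 0 = 0"
    using assms by (simp add: A_def p_def fps_divide_unit[OF q0] fps_of_poly_mult fps_of_poly_monom)
  hence "fps_X * Abs_fps (\<lambda>k. fps_nth A (Suc k)) = A"
    by (auto simp: fps_eq_iff fps_X_mult_nth)
  moreover have "\<beta> = (\<lambda>k. fps_nth A (Suc k))" if "fps_X * Abs_fps \<beta> = A" for \<beta>
    using that by auto
  ultimately have "\<exists>!\<beta>. fps_X * Abs_fps \<beta> = A" by blast
  hence "fps_X * Abs_fps (taylor_at_infinity (Fract P Q)) = A"
    unfolding taylor_at_infinity_def iff by (rule theI')
  thus ?thesis
    using q0 by (simp add: A_def p_def q_def fps_divide_unit mult.assoc inverse_mult_eq_1)
qed

section \<open>The Pade equations\<close>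

text \<open>Comparing initial segments of power series is invariant under multiplication by a unit. This lets the
condition on the first \<open>2r\<close> Taylor coefficients be tested after multiplication by the denominator.\<close>

lemma fps_mult_unit_agree_iff:
  fixes F G B :: "'a :: field fps"
  assumes "fps_nth B 0 \<noteq> 0"
  shows "(\<forall>m\<le>N. fps_nth (F * B) m = fps_nth (G * B) m) \<longleftrightarrow> (\<forall>m\<le>N. fps_nth F m = fps_nth G m)"
proof
  assume "\<forall>m\<le>N. fps_nth (F * B) m = fps_nth (G * B) m"
  hence "\<forall>m\<le>N. fps_nth (F * B * inverse B) m = fps_nth (G * B * inverse B) m"
    by (auto simp: fps_mult_nth[of _ "inverse B"] intro!: sum.cong)
  thus "\<forall>m\<le>N. fps_nth F m = fps_nth G m"
    using assms by (simp add: mult.assoc inverse_mult_eq_1')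
qed (auto simp: fps_mult_nth intro!: sum.cong)

text \<open>The next two lemmas compute the coefficients of \<open>Q(z) (\<beta>\<^sub>0/z + \<beta>\<^sub>1/z\<^sup>2 + \<dots>)\<close>: first
that of \<open>z\<^sup>k\<close>, which is the exponent \<open>deg Q - k\<close> of \<open>u = 1/z\<close> after multiplication by
\<open>u ^ deg Q\<close>, then that of \<open>1 / z ^ (i + 1)\<close>.\<close>

lemma fps_nth_mult_reflect_low:
  fixes \<beta> :: "nat \<Rightarrow> 'a :: comm_ring_1"
  assumes "k < degree Q"
  shows "fps_nth (fps_X * Abs_fps \<beta> * fps_of_poly (reflect_poly Q)) (degree Q - k) =
    (\<Sum>j\<in>{k<..degree Q}. coeff Q j * \<beta> (j - k - 1))"
proof -
  have "fps_nth (fps_X * Abs_fps \<beta> * fps_of_poly (reflect_poly Q)) (degree Q - k) =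
      (\<Sum>i\<in>{0<..degree Q - k}. \<beta> (i - 1) * coeff Q (k + i))"
    using assms by (subst fps_mult_nth, intro sum.mono_neutral_cong_right) (auto simp: coeff_reflect_poly intro!: arg_cong[of _ _ "coeff Q"])
  also have "\<dots> = (\<Sum>j\<in>{k<..degree Q}. coeff Q j * \<beta> (j - k - 1))"
    by (rule sum.reindex_bij_witness[of _ "\<lambda>j. j - k" "\<lambda>i. k + i"]) (use assms in auto)
  finally show ?thesis .
qed

lemma fps_nth_mult_reflect_high:
  fixes \<beta> :: "nat \<Rightarrow> 'a :: comm_ring_1"
  shows "fps_nth (fps_X * Abs_fps \<beta> * fps_of_poly (reflect_poly Q)) (degree Q + 1 + i) =
    (\<Sum>j\<le>degree Q. coeff Q j * \<beta> (i + j))"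
proof -
  have "fps_nth (fps_X * Abs_fps \<beta> * fps_of_poly (reflect_poly Q)) (degree Q + 1 + i) =
      (\<Sum>l\<in>{i+1..degree Q + 1 + i}. \<beta> (l - 1) * coeff Q (l - (i + 1)))"
    by (subst fps_mult_nth, intro sum.mono_neutral_cong_right) (auto simp: coeff_reflect_poly intro!: arg_cong[of _ _ "coeff Q"])
  also have "\<dots> = (\<Sum>j\<le>degree Q. coeff Q j * \<beta> (i + j))"
    by (rule sum.reindex_bij_witness[of _ "\<lambda>j. i + 1 + j" "\<lambda>l. l - (i + 1)"]) auto
  finally show ?thesis .
qed

text \<open>\<open>P/Q\<close> has initial Taylor coefficients \<open>\<mu>\<close> iff the product of \<open>Q\<close> with the series of \<open>\<mu>\<close> agrees with
\<open>P\<close> down to the power \<open>1/z\<^sup>r\<close>. The nonnegative powers of \<open>z\<close> determine \<open>P\<close>; the powers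
\<open>1/z, \<dots>, 1/z\<^sup>r\<close> must vanish, which is the Hankel recurrence for \<open>Q\<close>.\<close>

lemma taylor_coeffs_Fract_iff:
  assumes "degree P < r" "degree Q = r" "\<mu> \<in> topspace (complex_space (2 * r))"
  shows "taylor_coeffs r (Fract P Q) = \<mu> \<longleftrightarrow>
    (\<forall>k<r. coeff P k = (\<Sum>j\<in>{k<..r}. coeff Q j * \<mu> (j - k - 1))) \<and>
    (\<forall>i<r. (\<Sum>j\<le>r. coeff Q j * \<mu> (i + j)) = 0)"
proof -
  define \<alpha> where "\<alpha> = taylor_at_infinity (Fract P Q)"
  define B where "B = fps_of_poly (reflect_poly Q)"
  define N where "N = fps_of_poly (monom 1 (degree Q - degree P) * reflect_poly P)"
  have B0: "fps_nth B 0 \<noteq> 0" using assms by (auto simp: B_def)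
  have N: "fps_X * Abs_fps \<alpha> * B = N"
    using taylor_at_infinity_Fract[of P Q] assms by (simp add: \<alpha>_def B_def N_def)
  have N_low: "fps_nth N (r - k) = coeff P k" if "k < r" for k
    using assms that by (auto simp: N_def coeff_monom_mult coeff_reflect_poly coeff_eq_0
        intro!: arg_cong[of _ _ "coeff P"])
  have N_high: "fps_nth N (r + 1 + i) = 0" for i
    using assms by (auto simp: N_def coeff_monom_mult coeff_reflect_poly)
  have "taylor_coeffs r (Fract P Q) = \<mu> \<longleftrightarrow> (\<forall>k<2 * r. \<mu> k = \<alpha> k)"
    using assms(3) by (auto simp: taylor_coeffs_def \<alpha>_def complex_space_def fun_eq_iff PiE_def extensional_def)
  also have "\<dots> \<longleftrightarrow> (\<forall>m\<le>2 * r. fps_nth (fps_X * Abs_fps \<mu>) m = fps_nth (fps_X * Abs_fps \<alpha>) m)"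
  proof
    assume "\<forall>m\<le>2 * r. fps_nth (fps_X * Abs_fps \<mu>) m = fps_nth (fps_X * Abs_fps \<alpha>) m"
    hence "fps_nth (fps_X * Abs_fps \<mu>) (Suc k) = fps_nth (fps_X * Abs_fps \<alpha>) (Suc k)" if "k < 2 * r" for k
      using that by (meson Suc_leI)
    thus "\<forall>k<2 * r. \<mu> k = \<alpha> k" by simp
  qed auto
  also have "\<dots> \<longleftrightarrow> (\<forall>m\<le>2 * r. fps_nth (fps_X * Abs_fps \<mu> * B) m = fps_nth N m)"
    by (simp only: N[symmetric] fps_mult_unit_agree_iff[OF B0])
  \<comment> \<open>Exponents 1 to r become r - k, exponents r + 1 to 2r become r + 1 + i; exponent 0 is trivial as both series vanish there.\<close>
  also have "\<dots> \<longleftrightarrow> (\<forall>k<r. fps_nth (fps_X * Abs_fps \<mu> * B) (r - k) = fps_nth N (r - k)) \<and>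
     (\<forall>i<r. fps_nth (fps_X * Abs_fps \<mu> * B) (r + 1 + i) = fps_nth N (r + 1 + i))"
    (is "?L \<longleftrightarrow> ?R")
  proof
    assume R: ?R
    have zero: "fps_nth (fps_X * Abs_fps \<mu> * B) 0 = fps_nth N 0"
      by (simp flip: N)
    have "fps_nth (fps_X * Abs_fps \<mu> * B) m = fps_nth N m" if "m \<le> 2 * r" for m
    proof -
      consider "m = 0" | "0 < m" "m \<le> r" | "r < m" by linarith
      thus ?thesis
      proof cases
        case 1 with zero show ?thesis by simp
      next
        case 2
        hence "r - m < r" "r - (r - m) = m" by auto
        with R show ?thesis by metis
      next
        case 3
        hence "m - r - 1 < r" "r + 1 + (m - r - 1) = m" using that by auto
        with R show ?thesis by metis
      qed
    qed
    thus ?L by blast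
  qed auto
  also have "\<dots> \<longleftrightarrow> (\<forall>k<r. (\<Sum>j\<in>{k<..r}. coeff Q j * \<mu> (j - k - 1)) = coeff P k) \<and>
    (\<forall>i<r. (\<Sum>j\<le>r. coeff Q j * \<mu> (i + j)) = 0)"
  proof -
    have "fps_nth (fps_X * Abs_fps \<mu> * B) (r - k) = (\<Sum>j\<in>{k<..r}. coeff Q j * \<mu> (j - k - 1))"
      if "k < r" for k
      using fps_nth_mult_reflect_low[of k Q \<mu>] that assms(2) by (simp only: B_def)
    moreover have "fps_nth (fps_X * Abs_fps \<mu> * B) (r + 1 + i) = (\<Sum>j\<le>r. coeff Q j * \<mu> (i + j))" for i
      using fps_nth_mult_reflect_high[of \<mu> Q i] assms(2) by (simp only: B_def)
    ultimately show ?thesis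
      using N_low N_high by (simp cong: conj_cong imp_cong)
  qed
  finally show ?thesis by (simp only: eq_commute[of "coeff P _"])
qed

section \<open>The solution of the Pade equations\<close>

text \<open>Cramer's formula for the lower coefficients of the monic denominator. The explicit formula, rather
than an abstract inverse matrix, is what makes continuity in \<open>\<mu>\<close> visible.\<close>

definition hankel_cramer :: "nat \<Rightarrow> (nat \<Rightarrow> complex) \<Rightarrow> nat \<Rightarrow> complex" where
  "hankel_cramer r \<mu> k =
     Determinant.det (replace_col (hankel_square r \<mu>) (Matrix.vec r (\<lambda>i. - \<mu> (i + r))) k) /
     Determinant.det (hankel_square r \<mu>)"

definition pade_den :: "nat \<Rightarrow> (nat \<Rightarrow> complex) \<Rightarrow> complex poly" where
  "pade_den r \<mu> = monom 1 r + (\<Sum>j<r. monom (hankel_cramer r \<mu> j) j)"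

definition pade_num :: "nat \<Rightarrow> (nat \<Rightarrow> complex) \<Rightarrow> complex poly" where
  "pade_num r \<mu> =
     (\<Sum>k<r. monom (\<Sum>j\<in>{k<..r}. coeff (pade_den r \<mu>) j * \<mu> (j - k - 1)) k)"

text \<open>Cramer's rule identifies every solution with the quotient of determinants; the adjugate matrix provides
a solution, so that the quotients do solve the system.\<close>

lemma hankel_system_iff:
  assumes det: "Determinant.det (hankel_square r \<mu>) \<noteq> 0"
  shows "(\<forall>i<r. (\<Sum>j<r. x j * \<mu> (i + j)) = - \<mu> (i + r)) \<longleftrightarrow> (\<forall>j<r. x j = hankel_cramer r \<mu> j)"
proof -
  define H where "H = hankel_square r \<mu>"
  define b where "b = Matrix.vec r (\<lambda>i. - \<mu> (i + r))"
  have H: "H \<in> carrier_mat r r" by (simp add: H_def hankel_square_def)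
  have sys: "(\<forall>i<r. (\<Sum>j<r. y j * \<mu> (i + j)) = - \<mu> (i + r)) \<longleftrightarrow> H *\<^sub>v Matrix.vec r y = b" for y
    by (auto simp: H_def hankel_square_def b_def Matrix.vec_eq_iff scalar_prod_def
        atLeast0LessThan mult.commute)
  have cramer: "y k = hankel_cramer r \<mu> k" if "H *\<^sub>v Matrix.vec r y = b" "k < r" for y k
    using cramer_lemma_mat[OF H, of "Matrix.vec r y" k] that det
    by (simp add: hankel_cramer_def H_def b_def)
  define s where "s = inverse (Determinant.det H) \<cdot>\<^sub>v (adj_mat H *\<^sub>v b)"
  have b: "b \<in> carrier_vec r" by (simp add: b_def)
  have s: "s = Matrix.vec r (vec_index s)" 
    using adj_mat(1)[OF H] by (auto simp: s_def)
  have "H *\<^sub>v s = inverse (Determinant.det H) \<cdot>\<^sub>v (H *\<^sub>v (adj_mat H *\<^sub>v b))"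
    unfolding s_def using H adj_mat(1)[OF H] b by (intro mult_mat_vec) auto
  also have "H *\<^sub>v (adj_mat H *\<^sub>v b) = (H * adj_mat H) *\<^sub>v b"
    using H adj_mat(1)[OF H] b by (rule assoc_mult_mat_vec[symmetric])
  also have "\<dots> = Determinant.det H \<cdot>\<^sub>v b"
    unfolding adj_mat(2)[OF H] using b by (intro eq_vecI) (auto simp: row_smult)
  finally have "H *\<^sub>v s = b"
    using det b by (simp add: H_def smult_smult_assoc)
  hence sol: "H *\<^sub>v Matrix.vec r (vec_index s) = b" using s by simp
  have "H *\<^sub>v Matrix.vec r x = b" if "\<forall>j<r. x j = hankel_cramer r \<mu> j"
  proof -
    have "Matrix.vec r x = Matrix.vec r (vec_index s)" using that cramer[OF sol] by (intro eq_vecI) auto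
    thus ?thesis using sol by simp
  qed
  thus ?thesis using sys cramer by blast
qed

lemma coeff_pade_den:
  "coeff (pade_den r \<mu>) j = (if j < r then hankel_cramer r \<mu> j else if j = r then 1 else 0)"
  by (simp add: pade_den_def coeff_sum)

lemma coeff_pade_num:
  "coeff (pade_num r \<mu>) k =
     (if k < r then \<Sum>j\<in>{k<..r}. coeff (pade_den r \<mu>) j * \<mu> (j - k - 1) else 0)"
  by (simp add: pade_num_def coeff_sum)

lemma degree_pade_den: "degree (pade_den r \<mu>) = r" 
  by (intro antisym degree_le le_degree) (auto simp: coeff_pade_den)

lemma degree_pade_num: "r \<ge> 1 \<Longrightarrow> degree (pade_num r \<mu>) < r"
  using degree_le[of "r - 1" "pade_num r \<mu>"] by (force simp: coeff_pade_num)

text \<open>For monic \<open>Q\<close> the top term of the recurrence moves to the right-hand side, and the recurrence becomes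
the linear system with the invertible matrix \<open>M_r\<close>.\<close>

lemma taylor_coeffs_eq_iff_pade:
  assumes \<mu>: "\<mu> \<in> topspace (complex_space (2 * r))"
    and det: "Determinant.det (hankel_square r \<mu>) \<noteq> 0"
    and PQ: "degree P < r" "degree Q = r" "lead_coeff Q = 1"
  shows "taylor_coeffs r (Fract P Q) = \<mu> \<longleftrightarrow> P = pade_num r \<mu> \<and> Q = pade_den r \<mu>"
proof -
  have "(\<Sum>j\<le>r. coeff Q j * \<mu> (i + j)) = (\<Sum>j<r. coeff Q j * \<mu> (i + j)) + \<mu> (i + r)" for i
    using PQ by (simp add: lessThan_Suc_atMost[symmetric])
  hence "(\<forall>i<r. (\<Sum>j\<le>r. coeff Q j * \<mu> (i + j)) = 0) \<longleftrightarrow> (\<forall>j<r. coeff Q j = hankel_cramer r \<mu> j)"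
    by (simp add: eq_neg_iff_add_eq_0 flip: hankel_system_iff[OF det])
  also have "\<dots> \<longleftrightarrow> Q = pade_den r \<mu>"
    using PQ by (auto simp: poly_eq_iff coeff_pade_den coeff_eq_0)
  finally have Q: "(\<forall>i<r. (\<Sum>j\<le>r. coeff Q j * \<mu> (i + j)) = 0) \<longleftrightarrow> Q = pade_den r \<mu>" .
  have P: "(\<forall>k<r. coeff P k = (\<Sum>j\<in>{k<..r}. coeff (pade_den r \<mu>) j * \<mu> (j - k - 1))) \<longleftrightarrow>
      P = pade_num r \<mu>"
    using PQ(1) by (auto simp: poly_eq_iff coeff_pade_num coeff_eq_0)
  show ?thesis
    unfolding taylor_coeffs_Fract_iff[OF PQ(1,2) \<mu>] Q using P by blast
qed

section \<open>Rational functions and their representations\<close>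

text \<open>A denominator of degree \<open>n \<le> r\<close> reaches degree \<open>r\<close> when numerator and denominator are multiplied by a
scalar multiple of \<open>z ^ (r - n)\<close>. As such representations need not be reduced, all functions of degree at most \<open>r\<close>,
including zero, are treated by the same linear system.\<close>

lemma proper_ratfuns_eq_monic:
  "proper_ratfuns r = {Fract P Q | P Q. degree P < r \<and> degree Q = r \<and> lead_coeff Q = 1}"
proof (intro equalityI subsetI)
  fix R assume "R \<in> proper_ratfuns r"
  then obtain P Q where R: "R = Fract P Q" and deg: "degree P < degree Q" "degree Q \<le> r"
    by (auto simp: proper_ratfuns_def)
  define G where "G = monom (inverse (lead_coeff Q)) (r - degree Q)"
  have Q0: "Q \<noteq> 0" using deg by auto
  hence G: "G \<noteq> 0" "degree G = r - degree Q" "lead_coeff G = inverse (lead_coeff Q)"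
    by (simp_all add: G_def degree_monom_eq)
  have "R = Fract (G * P) (G * Q)"
    using R G Q0 by (simp add: Fract_mult_cancel_left)
  moreover have "degree (G * P) < r"
    using deg G by (cases "P = 0") (auto simp: degree_mult_eq)
  moreover have "degree (G * Q) = r"
    using deg G Q0 by (simp add: degree_mult_eq)
  moreover have "lead_coeff (G * Q) = 1"
    unfolding lead_coeff_mult G(3) using Q0 by simp
  ultimately show "R \<in> {Fract P Q | P Q. degree P < r \<and> degree Q = r \<and> lead_coeff Q = 1}"
    by blast
qed (auto simp: proper_ratfuns_def)

text \<open>By the fundamental theorem of algebra, every monic denominator of degree \<open>r\<close> splits into \<open>r\<close>
linear factors, whose roots are the required poles.\<close>

lemma stieltjes_space_ratfun_iff:
  "(\<exists>w. (w, \<gamma>) \<in> stieltjes_space r) \<longleftrightarrow> \<gamma> \<in> proper_ratfuns r"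
proof
  assume "\<exists>w. (w, \<gamma>) \<in> stieltjes_space r"
  thus "\<gamma> \<in> proper_ratfuns r"
    by (fastforce simp: stieltjes_space_def proper_ratfuns_def degree_prod_eq_sum_degree)
next
  assume "\<gamma> \<in> proper_ratfuns r"
  then obtain P Q where \<gamma>: "\<gamma> = Fract P Q" and PQ: "degree P < r" "degree Q = r" "lead_coeff Q = 1"
    by (auto simp: proper_ratfuns_eq_monic)
  obtain x where "Polynomial.smult (lead_coeff Q) (\<Prod>i<degree Q. [:- x i, 1:]) = Q"
    by (rule complex_poly_decompose')
  hence Q: "Q = (\<Prod>i<r. [:- restrict x {..<r} i, 1:])"
    using PQ by simp
  have "restrict x {..<r} \<in> topspace (complex_space r)"
    by (simp add: complex_space_def)
  hence "(restrict x {..<r}, \<gamma>) \<in> stieltjes_space r"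
    unfolding stieltjes_space_def mem_Collect_eq
    by (intro exI[of _ "restrict x {..<r}"] exI[of _ P])
       (use \<gamma> PQ(1,2) in \<open>simp only: Q[symmetric] simp_thms\<close>)
  thus "\<exists>w. (w, \<gamma>) \<in> stieltjes_space r" by blast
qed

text \<open>A common factor \<open>G\<close> of positive degree could be exchanged for \<open>G + 1\<close>, which has the same degree and
the same leading coefficient. The new fraction is the same rational function, so it solves the same
Pade problem, and uniqueness of the monic denominator is violated. The argument covers a vanishing
numerator as well, where the denominator is itself the common factor.\<close>

lemma coprime_pade:
  assumes r: "r \<ge> 1" and \<mu>: "\<mu> \<in> topspace (complex_space (2 * r))"
    and det: "Determinant.det (hankel_square r \<mu>) \<noteq> 0"
  shows "coprime (pade_num r \<mu>) (pade_den r \<mu>)"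
proof -
  let ?P = "pade_num r \<mu>" and ?Q = "pade_den r \<mu>"
  define G where "G = gcd ?P ?Q"
  obtain P1 where P1: "?P = G * P1" unfolding G_def using gcd_dvd1 by (rule dvdE)
  obtain Q1 where Q1: "?Q = G * Q1" unfolding G_def using gcd_dvd2 by (rule dvdE)
  have deg: "degree ?P < r" "degree ?Q = r" "lead_coeff ?Q = 1"
    using degree_pade_num[OF r] degree_pade_den by (auto simp: coeff_pade_den)
  have nz: "G \<noteq> 0" "Q1 \<noteq> 0" using deg Q1 by auto
  have "degree G = 0"
  proof (rule ccontr)
    assume G: "degree G \<noteq> 0"
    define H where "H = G + 1"
    have H: "degree H = degree G" "lead_coeff H = lead_coeff G"
      using G by (simp_all add: H_def degree_add_eq_left coeff_eq_0)
    have H0: "H \<noteq> 0" using H G by auto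
    have "taylor_coeffs r (Fract ?P ?Q) = \<mu>"
      using taylor_coeffs_eq_iff_pade[OF \<mu> det deg] by simp
    hence "taylor_coeffs r (Fract (H * P1) (H * Q1)) = \<mu>"
      using nz H0 by (simp add: P1 Q1 Fract_mult_cancel_left)
    moreover have "degree (H * P1) = degree ?P" "degree (H * Q1) = degree ?Q" 
      using nz H0 H by (cases "P1 = 0", simp_all add: P1 Q1 degree_mult_eq)
    moreover have "lead_coeff (H * Q1) = lead_coeff ?Q"
      by (simp only: Q1 lead_coeff_mult H(2))
    ultimately have "H * Q1 = G * Q1"
      using taylor_coeffs_eq_iff_pade[OF \<mu> det, of "H * P1" "H * Q1"] deg Q1 by simp
    thus False using nz by (simp add: H_def)
  qed
  hence "is_unit G" using nz by (simp add: is_unit_iff_degree)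
  thus ?thesis unfolding G_def by (simp only: is_unit_gcd)
qed

lemma ratfun_num_den_Fract:
  assumes "coprime P Q" "lead_coeff Q = 1"
  shows "ratfun_num (Fract P Q) = P" "ratfun_den (Fract P Q) = Q"
proof -
  have "(P, Q) \<in> normalized_fracts"
    using assms by (simp add: normalized_fracts_def unit_factor_poly_def)
  from quot_of_fract_quot_to_fract'[OF this] have "quot_of_fract (Fract P Q) = (P, Q)"
    by (simp add: quot_to_fract_def)
  thus "ratfun_num (Fract P Q) = P" "ratfun_den (Fract P Q) = Q"
    by (simp_all add: ratfun_num_def ratfun_den_def)
qed

section \<open>Continuous dependence on the Taylor coefficients\<close>

lemma continuous_map_det:
  fixes A :: "'a \<Rightarrow> 'b :: real_normed_field mat"
  assumes "\<And>x. A x \<in> carrier_mat n n"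
    and "\<And>i j. i < n \<Longrightarrow> j < n \<Longrightarrow> continuous_map X euclidean (\<lambda>x. A x $$ (i, j))"
  shows "continuous_map X euclidean (\<lambda>x. Determinant.det (A x))"
  using assms(2) unfolding det_def'[OF assms(1)] continuous_map_atin limitin_canonical_iff
  by (intro ballI tendsto_intros) (auto dest: permutes_in_image)

lemma continuous_map_coordinate:
  "i < n \<Longrightarrow> continuous_map (complex_space n) euclidean (\<lambda>\<mu>. \<mu> i)"
  unfolding complex_space_def by (rule continuous_map_product_projection) simp

lemma continuous_map_det_hankel:
  "continuous_map (complex_space (2 * r)) euclidean (\<lambda>\<mu>. Determinant.det (hankel_square r \<mu>))"
  by (rule continuous_map_det[where n = r])
     (auto simp: hankel_square_def intro: continuous_map_coordinate)

lemma openin_det_hankel_nonzero: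
  "openin (complex_space (2 * r))
     {\<mu> \<in> topspace (complex_space (2 * r)). Determinant.det (hankel_square r \<mu>) \<noteq> 0}"
  using openin_continuous_map_preimage[OF continuous_map_det_hankel[of r], of "- {0}"]
  by (simp add: open_Compl)

lemma continuous_map_coeff_pade:
  assumes "\<And>\<mu>. \<mu> \<in> U \<Longrightarrow> Determinant.det (hankel_square r \<mu>) \<noteq> 0"
  shows "continuous_map (subtopology (complex_space (2 * r)) U) euclidean (\<lambda>\<mu>. coeff (pade_den r \<mu>) j)"
    (is "?den j")
    and "continuous_map (subtopology (complex_space (2 * r)) U) euclidean (\<lambda>\<mu>. coeff (pade_num r \<mu>) k)"
    (is ?num)
proof -
  let ?X = "subtopology (complex_space (2 * r)) U"
  have coord: "continuous_map ?X euclidean (\<lambda>\<mu>. \<mu> i)" if "i < 2 * r" for i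
    using continuous_map_coordinate[OF that] by (rule continuous_map_from_subtopology)
  have "continuous_map ?X euclidean (\<lambda>\<mu>. hankel_cramer r \<mu> j)" if "j < r" for j
  proof -
    let ?A = "\<lambda>\<mu>. replace_col (hankel_square r \<mu>) (Matrix.vec r (\<lambda>i. - \<mu> (i + r))) j"
    have "continuous_map ?X euclidean (\<lambda>\<mu>. Determinant.det (?A \<mu>))"
    proof (rule continuous_map_det[where n = r])
      fix i l assume "i < r" "l < r"
      thus "continuous_map ?X euclidean (\<lambda>\<mu>. ?A \<mu> $$ (i, l))"
        by (cases "l = j") (auto simp: replace_col_def hankel_square_def intro!: coord continuous_map_minus)
    qed (simp add: replace_col_def hankel_square_def)
    moreover have "continuous_map ?X euclidean (\<lambda>\<mu>. Determinant.det (hankel_square r \<mu>))"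
      by (rule continuous_map_from_subtopology[OF continuous_map_det_hankel])
    ultimately show ?thesis
      using assms unfolding hankel_cramer_def continuous_map_atin limitin_canonical_iff
      by (auto intro!: tendsto_divide)
  qed
  thus den: "?den j" for j
    by (cases "j < r") (simp_all add: coeff_pade_den)
  show ?num
  proof (cases "k < r")
    case True
    have "continuous_map ?X euclidean (\<lambda>\<mu>. coeff (pade_den r \<mu>) j * \<mu> (j - k - 1))" if "j \<le> r" for j
      using den[of j] coord[of "j - k - 1"] that True
      unfolding continuous_map_atin limitin_canonical_iff by (auto intro!: tendsto_mult)
    thus ?thesis
      using True unfolding coeff_pade_num continuous_map_atin limitin_canonical_iff
      by (auto intro!: tendsto_sum)
  qed (simp add: coeff_pade_num)
qed

text \<open>The topology is pulled back from a product of sequence spaces, so continuity is tested on each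
coefficient of the reduced fraction.\<close>

lemma continuous_map_ratfun_topologyI:
  assumes "\<And>x. x \<in> topspace X \<Longrightarrow> f x \<in> proper_ratfuns r"
    and "\<And>k. continuous_map X euclidean (\<lambda>x. coeff (ratfun_num (f x)) k)"
    and "\<And>k. continuous_map X euclidean (\<lambda>x. coeff (ratfun_den (f x)) k)"
  shows "continuous_map X (ratfun_topology r) f"
  unfolding ratfun_topology_def
proof (rule continuous_map_pullback')
  have "continuous_map X euclidean (\<lambda>x. coeff (ratfun_num (f x)))"
       "continuous_map X euclidean (\<lambda>x. coeff (ratfun_den (f x)))"
    using assms(2,3) by (simp_all add: continuous_map_componentwise_UNIV flip: euclidean_product_topology)
  thus "continuous_map X euclidean ((\<lambda>R. (coeff (ratfun_num R), coeff (ratfun_den R))) \<circ> f)"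
    by (simp add: o_def continuous_map_paired flip: prod_topology_euclidean)
qed (use assms(1) in auto)

section \<open>Local inversion of the Taylor mapping\<close>

lemma Sigma_star_subset:
  assumes "1 \<le> r"
  shows "Sigma_star d r \<subseteq>
    {\<mu> \<in> topspace (complex_space (2 * r)). Determinant.det (hankel_square r \<mu>) \<noteq> 0}"
proof -
  have "hankel_square r (restrict \<mu> {..<2 * r}) = hankel_square r \<mu>" for \<mu>
    by (rule eq_matI) (auto simp: hankel_square_def)
  thus ?thesis
    by (auto simp: Sigma_star_def Sigma_rank_def complex_space_def)
qed

theorem theorem5p7:
  fixes d r :: nat and \<mu>0 :: "nat \<Rightarrow> complex"
  assumes "1 \<le> r" and "r \<le> d" and "\<mu>0 \<in> Sigma_star d r"
  shows "\<exists>U TMinv. openin (complex_space (2 * r)) U \<and> \<mu>0 \<in> U \<and>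
    (\<forall>\<mu>\<in>U. \<exists>!R. R \<in> proper_ratfuns r \<and> taylor_coeffs r R = \<mu>) \<and>
    (\<forall>\<mu>\<in>U. TMinv \<mu> \<in> proper_ratfuns r \<and> taylor_coeffs r (TMinv \<mu>) = \<mu>) \<and>
    (\<forall>\<mu>\<in>U. {\<gamma>. \<exists>w. (w, \<gamma>) \<in> stieltjes_space r \<and> taylor_mapping r (w, \<gamma>) = \<mu>} = {TMinv \<mu>}) \<and>
    continuous_map (subtopology (complex_space (2 * r)) U) (ratfun_topology r) TMinv"
proof -
  define U where
    "U = {\<mu> \<in> topspace (complex_space (2 * r)). Determinant.det (hankel_square r \<mu>) \<noteq> 0}"
  define T where "T = (\<lambda>\<mu>. Fract (pade_num r \<mu>) (pade_den r \<mu>))"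
  have deg: "degree (pade_num r \<mu>) < r" "degree (pade_den r \<mu>) = r" "lead_coeff (pade_den r \<mu>) = 1" for \<mu>
    using degree_pade_num[OF assms(1)] degree_pade_den by (auto simp: coeff_pade_den)
  have inv: "R \<in> proper_ratfuns r \<and> taylor_coeffs r R = \<mu> \<longleftrightarrow> R = T \<mu>" if "\<mu> \<in> U" for \<mu> R
  proof -
    have "\<mu> \<in> topspace (complex_space (2 * r))" "Determinant.det (hankel_square r \<mu>) \<noteq> 0"
      using that by (auto simp: U_def)
    note iff = taylor_coeffs_eq_iff_pade[OF this]
    show ?thesis
    proof
      assume "R \<in> proper_ratfuns r \<and> taylor_coeffs r R = \<mu>"
      then obtain P Q where "R = Fract P Q" "degree P < r" "degree Q = r" "lead_coeff Q = 1"
          "taylor_coeffs r (Fract P Q) = \<mu>"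
        by (auto simp: proper_ratfuns_eq_monic)
      thus "R = T \<mu>" using iff by (simp add: T_def)
    next
      assume "R = T \<mu>"
      thus "R \<in> proper_ratfuns r \<and> taylor_coeffs r R = \<mu>"
        using iff[OF deg] deg unfolding T_def proper_ratfuns_eq_monic by blast
    qed
  qed
  have "{\<gamma>. \<exists>w. (w, \<gamma>) \<in> stieltjes_space r \<and> taylor_mapping r (w, \<gamma>) = \<mu>} = {T \<mu>}" if "\<mu> \<in> U" for \<mu>
    using inv[OF that] stieltjes_space_ratfun_iff[of _ r] by (auto simp: taylor_mapping_def)
  moreover have "continuous_map (subtopology (complex_space (2 * r)) U) (ratfun_topology r) T"
  proof (rule continuous_map_ratfun_topologyI)
    let ?X = "subtopology (complex_space (2 * r)) U"
    \<comment> \<open>Coprimality is essential here: the topology only sees the reduced fraction.\<close>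
    have red: "ratfun_num (T \<mu>) = pade_num r \<mu>" "ratfun_den (T \<mu>) = pade_den r \<mu>"
      if "\<mu> \<in> topspace ?X" for \<mu>
      using that coprime_pade[OF assms(1)] deg by (auto simp: T_def U_def ratfun_num_den_Fract)
    show "T \<mu> \<in> proper_ratfuns r" if "\<mu> \<in> topspace ?X" for \<mu>
      using that inv[of \<mu>] by auto
    show "continuous_map ?X euclidean (\<lambda>\<mu>. coeff (ratfun_num (T \<mu>)) k)" for k
      by (rule continuous_map_eq[OF continuous_map_coeff_pade(2)]) (auto simp: red U_def)
    show "continuous_map ?X euclidean (\<lambda>\<mu>. coeff (ratfun_den (T \<mu>)) k)" for k
      by (rule continuous_map_eq[OF continuous_map_coeff_pade(1)]) (auto simp: red U_def)
  qed
  moreover have "openin (complex_space (2 * r)) U"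
    unfolding U_def by (rule openin_det_hankel_nonzero)
  moreover have "\<exists>!R. R \<in> proper_ratfuns r \<and> taylor_coeffs r R = \<mu>"
      "T \<mu> \<in> proper_ratfuns r \<and> taylor_coeffs r (T \<mu>) = \<mu>" if "\<mu> \<in> U" for \<mu>
    using that by (simp_all add: inv)
  moreover have "\<mu>0 \<in> U"
    using Sigma_star_subset[OF assms(1)] assms(3) unfolding U_def by blast
  ultimately show ?thesis
    by (intro exI[of _ U] exI[of _ T] conjI ballI) simp_all
qed

end
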